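(* Let $\mathcal{M}$ and $\mathcal{Q}$ be matroids with $E(\mathcal{M})\cap E(\mathcal{Q})=\{g\}$, and let $\mathcal{N}=\mathcal{M}\oplus_g\mathcal{Q}$ be their $2$-sum along $g$. If $\mathcal{M}$ and $\mathcal{Q}$ are Rayleigh matroids, then $\mathcal{N}$ is a Rayleigh matroid.
   Context: For a matroid $\mathcal{M}$ on a finite set $E$ with indeterminates $\mathbf{y}=\{y_c:c\in E\}$ and disjoint $I,J\subseteq E$, $M_I^J(\mathbf{y}):=\sum_B\prod_{c\in B\setminus I}y_c$, summed over bases $B$ with $I\subseteq B$, $B\cap J=\varnothing$. For distinct $e,f$: $\Delta M\{e,f\}:=M_e^fM_f^e-M_{ef}M^{ef}$. A matroid is Rayleigh if $\Delta M\{e,f\}(\mathbf{y})\ge0$ for all distinct $e,f$ of its ground set whenever all $y_c>0$. The $2$-sum $\mathcal{M}\oplus_g\mathcal{Q}$ is the matroid on $(E(\mathcal{M})\cup E(\mathcal{Q}))\setminus\{g\}$ whose bases are the sets $B_1\cup B_2$ where either $B_1=B\setminus\{g\}$ for a basis $B\ni g$ of $\mathcal{M}$ and $B_2$ is a basis of $\mathcal{Q}$ not containing $g$, or $B_1$ is a basis of $\mathcal{M}$ not containing $g$ and $B_2=B'\setminus\{g\}$ for a basis $B'\ni g$ of $\mathcal{Q}$. *)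

theory Defs
  imports Complex_Main
begin

record 'a basis_system =
  ground :: "'a set"
  bases :: "'a set set"

locale matroid =
  fixes M :: "'a basis_system"
  assumes finite_ground: "finite (ground M)"
    and bases_subset: "B \<in> bases M \<Longrightarrow> B \<subseteq> ground M"
    and bases_nonempty: "bases M \<noteq> {}"
    and basis_exchange:
      "\<lbrakk>A \<in> bases M; B \<in> bases M; a \<in> A - B\<rbrakk> \<Longrightarrow> \<exists>b\<in>B - A. insert b (A - {a}) \<in> bases M"

text \<open>
  \<open>basis_poly M I J y\<close> is the value at the real point \<open>y\<close> of the polynomial that is
  written $M_I^J(\mathbf{y})$, for disjoint \<open>I\<close> and \<open>J\<close>: the lower index set is
  contained in the bases and its variables are divided out, the upper one is avoided.
\<close>
definition basis_poly :: "'a basis_system \<Rightarrow> 'a set \<Rightarrow> 'a set \<Rightarrow> ('a \<Rightarrow> real) \<Rightarrow> real" where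
  "basis_poly M I J y = (\<Sum>B | B \<in> bases M \<and> I \<subseteq> B \<and> B \<inter> J = {}. \<Prod>c\<in>B - I. y c)"

definition rayleigh_difference :: "'a basis_system \<Rightarrow> 'a \<Rightarrow> 'a \<Rightarrow> ('a \<Rightarrow> real) \<Rightarrow> real" where
  "rayleigh_difference M e f y =
     basis_poly M {e} {f} y * basis_poly M {f} {e} y
     - basis_poly M {e, f} {} y * basis_poly M {} {e, f} y"

definition rayleigh_matroid :: "'a basis_system \<Rightarrow> bool" where
  "rayleigh_matroid M \<longleftrightarrow> matroid M \<and>
     (\<forall>e\<in>ground M. \<forall>f\<in>ground M. e \<noteq> f \<longrightarrow>
        (\<forall>y. (\<forall>c\<in>ground M. 0 < y c) \<longrightarrow> 0 \<le> rayleigh_difference M e f y))"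

text \<open>
  If \<open>g\<close> is a loop of both \<open>M\<close> and \<open>Q\<close>, or a coloop of both, then no set meets the
  description of a basis of the 2-sum, and \<open>two_sum M g Q\<close> is not a matroid because
  its family of bases is empty.
\<close>
definition two_sum :: "'a basis_system \<Rightarrow> 'a \<Rightarrow> 'a basis_system \<Rightarrow> 'a basis_system" where
  "two_sum M g Q =
     \<lparr>ground = (ground M \<union> ground Q) - {g},
      bases = {(B - {g}) \<union> B2 | B B2. B \<in> bases M \<and> g \<in> B \<and> B2 \<in> bases Q \<and> g \<notin> B2}
            \<union> {B1 \<union> (B' - {g}) | B1 B'. B1 \<in> bases M \<and> g \<notin> B1 \<and> B' \<in> bases Q \<and> g \<in> B'}\<rparr>"

end

theory Submission
  imports Defs
begin

text \<open>
  The bases of the 2-sum split as $N = M_g Q^g + M^g Q_g$. If \<open>e\<close> and \<open>f\<close> both lie in \<open>M\<close>, then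
  $\Delta N\{e,f\}$ is $\Delta M\{e,f\}$ homogenised in $y_g$ and evaluated at the nonnegative pair
  $(Q^g, Q_g)$; if \<open>e\<close> lies in \<open>M\<close> and \<open>f\<close> in \<open>Q\<close>, then
  $\Delta N\{e,f\} = \Delta M\{e,g\}\,\Delta Q\{f,g\}$.
\<close>

section \<open>Bases of a single matroid\<close>

text \<open>Exchange would need an element of \<open>B - A\<close>, which is empty. This later keeps
  apart the bases of the 2-sum that take \<open>g\<close> from \<open>M\<close> and those that take
  it from \<open>Q\<close>.\<close>

lemma (in matroid) basis_antichain:
  assumes "A \<in> bases M" "B \<in> bases M" "B \<subseteq> A"
  shows "A = B"
proof (rule ccontr)
  assume "A \<noteq> B"
  with assms obtain a where "a \<in> A - B" by blast
  from basis_exchange[OF assms(1,2) this] assms(3) show False by blast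
qed

lemma (in matroid) finite_bases: "finite (bases M)"
  by (rule finite_subset[of _ "Pow (ground M)"]) (use bases_subset finite_ground in auto)

lemma (in matroid) finite_basis: "B \<in> bases M \<Longrightarrow> finite B"
  using bases_subset finite_ground finite_subset by blast

section \<open>The 2-sum as a matroid\<close>

lemma two_sum_commute: "two_sum M g Q = two_sum Q g M"
  unfolding two_sum_def by (simp add: Un_commute) blast

text \<open>Deleting \<open>g\<close> from the union affects only the one basis that contains it, so
  both families of the definition merge into a single form, symmetric in \<open>M\<close> and
  \<open>Q\<close>.\<close>

lemma two_sum_bases_iff:
  "C \<in> bases (two_sum M g Q) \<longleftrightarrow>
    (\<exists>A\<in>bases M. \<exists>B\<in>bases Q. (g \<in> A) \<noteq> (g \<in> B) \<and> C = (A \<union> B) - {g})"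
proof
  assume "C \<in> bases (two_sum M g Q)"
  then consider
    A B where "A \<in> bases M" "g \<in> A" "B \<in> bases Q" "g \<notin> B" "C = (A - {g}) \<union> B"
  | A B where "A \<in> bases M" "g \<notin> A" "B \<in> bases Q" "g \<in> B" "C = A \<union> (B - {g})"
    unfolding two_sum_def by auto
  then show "\<exists>A\<in>bases M. \<exists>B\<in>bases Q. (g \<in> A) \<noteq> (g \<in> B) \<and> C = (A \<union> B) - {g}"
  proof cases
    case (1 A B)
    then have "C = A \<union> B - {g}" by auto
    with 1 show ?thesis by blast
  next
    case (2 A B)
    then have "C = A \<union> B - {g}" by auto
    with 2 show ?thesis by blast
  qed
next
  assume "\<exists>A\<in>bases M. \<exists>B\<in>bases Q. (g \<in> A) \<noteq> (g \<in> B) \<and> C = (A \<union> B) - {g}"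
  then obtain A B where AB: "A \<in> bases M" "B \<in> bases Q" "(g \<in> A) \<noteq> (g \<in> B)" "C = (A \<union> B) - {g}"
    by blast
  show "C \<in> bases (two_sum M g Q)"
  proof (cases "g \<in> A")
    case True
    then have "C = (A - {g}) \<union> B" using AB(3,4) by blast
    with AB True have "C \<in> {(B - {g}) \<union> B2 | B B2. B \<in> bases M \<and> g \<in> B \<and> B2 \<in> bases Q \<and> g \<notin> B2}"
      by blast
    then show ?thesis unfolding two_sum_def basis_system.simps by (rule UnI1)
  next
    case False
    then have "C = A \<union> (B - {g})" using AB(3,4) by blast
    with AB False have "C \<in> {B1 \<union> (B' - {g}) | B1 B'. B1 \<in> bases M \<and> g \<notin> B1 \<and> B' \<in> bases Q \<and> g \<in> B'}"
      by blast
    then show ?thesis unfolding two_sum_def basis_system.simps by (rule UnI2)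
  qed
qed

lemma two_sum_basesI:
  "A \<in> bases M \<Longrightarrow> B \<in> bases Q \<Longrightarrow> (g \<in> A) \<noteq> (g \<in> B) \<Longrightarrow> A \<union> B - {g} \<in> bases (two_sum M g Q)"
  unfolding two_sum_bases_iff by blast

text \<open>The exchange is made inside \<open>M\<close>. If it brings in \<open>g\<close>, a second
  exchange in \<open>Q\<close> expels \<open>g\<close> there. Elements \<open>a\<close> of
  \<open>ground Q\<close> follow by \<open>two_sum_commute\<close>.\<close>

lemma two_sum_exchange:
  assumes "matroid M" "matroid Q" and ground: "ground M \<inter> ground Q = {g}"
    and A: "A \<in> bases (two_sum M g Q)" and B: "B \<in> bases (two_sum M g Q)"
    and a: "a \<in> A - B" "a \<in> ground M"
  shows "\<exists>b\<in>B - A. insert b (A - {a}) \<in> bases (two_sum M g Q)"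
proof -
  interpret M: matroid M by fact
  interpret Q: matroid Q by fact
  obtain A1 A2 where A12: "A1 \<in> bases M" "A2 \<in> bases Q" "(g \<in> A1) \<noteq> (g \<in> A2)" "A = A1 \<union> A2 - {g}"
    using A unfolding two_sum_bases_iff by blast
  obtain B1 B2 where B12: "B1 \<in> bases M" "B2 \<in> bases Q" "(g \<in> B1) \<noteq> (g \<in> B2)" "B = B1 \<union> B2 - {g}"
    using B unfolding two_sum_bases_iff by blast
  have sub: "A1 \<subseteq> ground M" "B1 \<subseteq> ground M" "A2 \<subseteq> ground Q" "B2 \<subseteq> ground Q"
    using A12 B12 M.bases_subset Q.bases_subset by auto
  have ag: "a \<noteq> g" using a A12 by auto
  \<comment> \<open>As \<open>g\<close> is the only shared element, \<open>a\<close> comes from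
    \<open>A1\<close> alone, and removing it leaves \<open>A2\<close> intact.\<close>
  then have aQ: "a \<notin> ground Q" using a ground by blast
  have "a \<in> A1 - B1" using a A12 B12 aQ sub by blast
  from M.basis_exchange[OF A12(1) B12(1) this] obtain b
    where b: "b \<in> B1 - A1" "insert b (A1 - {a}) \<in> bases M" by blast
  show ?thesis
  proof (cases "b = g")
    case False
    then have "b \<in> B - A" using b A12 B12 sub ground by blast
    moreover have eq: "insert b (A - {a}) = insert b (A1 - {a}) \<union> A2 - {g}"
      using A12(4) False aQ sub by blast
    moreover have "(g \<in> insert b (A1 - {a})) \<noteq> (g \<in> A2)" using A12(3) False ag by blast
    then have "insert b (A - {a}) \<in> bases (two_sum M g Q)"
      unfolding eq by (rule two_sum_basesI[OF b(2) A12(2)])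
    ultimately show ?thesis by blast
  next
    case True
    \<comment> \<open>Here \<open>g\<close> lies in \<open>B1\<close> but not in \<open>A1\<close>;
      exactly one basis of each pair contains \<open>g\<close>, so on the \<open>Q\<close> side the
      situation is reversed. Trading \<open>g\<close> for \<open>c\<close> in \<open>A2\<close>
      compensates for \<open>A1\<close> gaining \<open>g\<close>.\<close>
    then have "g \<in> A2 - B2" using b A12 B12 by blast
    from Q.basis_exchange[OF A12(2) B12(2) this] obtain c
      where c: "c \<in> B2 - A2" "insert c (A2 - {g}) \<in> bases Q" by blast
    have cg: "c \<noteq> g" using c \<open>g \<in> A2 - B2\<close> by blast
    then have "c \<in> B - A" using c A12 B12 sub ground by blast
    moreover have eq: "insert c (A - {a}) = insert b (A1 - {a}) \<union> insert c (A2 - {g}) - {g}"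
      using A12(4) True aQ sub cg by blast
    moreover have "(g \<in> insert b (A1 - {a})) \<noteq> (g \<in> insert c (A2 - {g}))"
      using True cg by blast
    then have "insert c (A - {a}) \<in> bases (two_sum M g Q)"
      unfolding eq by (rule two_sum_basesI[OF b(2) c(2)])
    ultimately show ?thesis by blast
  qed
qed

lemma matroid_two_sum:
  assumes MQ: "matroid M" "matroid Q" and ground: "ground M \<inter> ground Q = {g}"
    and nonempty: "bases (two_sum M g Q) \<noteq> {}"
  shows "matroid (two_sum M g Q)"
proof -
  interpret M: matroid M by fact
  interpret Q: matroid Q by fact
  have sub: "B \<subseteq> ground M \<union> ground Q - {g}" if "B \<in> bases (two_sum M g Q)" for B
    using that M.bases_subset Q.bases_subset unfolding two_sum_bases_iff by blast
  show ?thesis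
  proof
    show "finite (ground (two_sum M g Q))"
      using M.finite_ground Q.finite_ground by (simp add: two_sum_def)
    show "B \<subseteq> ground (two_sum M g Q)" if "B \<in> bases (two_sum M g Q)" for B
      using sub[OF that] by (simp add: two_sum_def)
    show "bases (two_sum M g Q) \<noteq> {}" by fact
    show "\<exists>b\<in>B - A. insert b (A - {a}) \<in> bases (two_sum M g Q)"
      if A: "A \<in> bases (two_sum M g Q)" and B: "B \<in> bases (two_sum M g Q)" and a: "a \<in> A - B"
      for A B a
    proof (cases "a \<in> ground M")
      case True
      then show ?thesis using two_sum_exchange[OF MQ ground A B a] by blast
    next
      case False
      then have "a \<in> ground Q" using sub[OF A] a by blast
      moreover have "ground Q \<inter> ground M = {g}" using ground by blast
      ultimately show ?thesis
        using two_sum_exchange[of Q M g A B a] MQ A B a by (simp add: two_sum_commute[of M])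
    qed
  qed
qed

section \<open>Basis polynomials and their dependence on the variables\<close>

lemma (in matroid) basis_poly_nonneg:
  assumes "\<And>c. c \<in> ground M \<Longrightarrow> c \<notin> I \<Longrightarrow> c \<notin> J \<Longrightarrow> 0 \<le> y c"
  shows "0 \<le> basis_poly M I J y"
  unfolding basis_poly_def using assms bases_subset by (intro sum_nonneg prod_nonneg) blast

text \<open>Variables in \<open>I\<close> are divided out and those in \<open>J\<close> never occur.
  In particular the value at \<open>g\<close> is irrelevant once \<open>g\<close> is in an index
  set.\<close>

lemma basis_poly_cong:
  assumes "matroid M" "\<And>c. c \<in> ground M \<Longrightarrow> c \<notin> I \<Longrightarrow> c \<notin> J \<Longrightarrow> y c = z c"
  shows "basis_poly M I J y = basis_poly M I J z"
proof -
  interpret matroid M by fact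
  show ?thesis
    unfolding basis_poly_def using assms(2) bases_subset by (intro sum.cong prod.cong) blast+
qed

lemma (in matroid) basis_poly_deletion_contraction:
  assumes "g \<notin> I" "g \<notin> J"
  shows "basis_poly M I J y = y g * basis_poly M (insert g I) J y + basis_poly M I (insert g J) y"
proof -
  let ?S = "{B \<in> bases M. I \<subseteq> B \<and> B \<inter> J = {}}"
  let ?p = "\<lambda>B. \<Prod>c\<in>B - I. y c"
  have fin: "finite ?S" using finite_bases by simp
  have "sum ?p ?S = sum ?p {B\<in>?S. g \<in> B} + sum ?p {B\<in>?S. g \<notin> B}"
    using sum.Int_Diff[OF fin, of ?p "{B. g \<in> B}"]
    by (simp add: Int_def set_diff_eq conj_ac)
  also have "sum ?p {B\<in>?S. g \<in> B} = (\<Sum>B\<in>{B\<in>?S. g \<in> B}. y g * (\<Prod>c\<in>B - insert g I. y c))"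
  proof (rule sum.cong[OF refl])
    fix B assume B: "B \<in> {B\<in>?S. g \<in> B}"
    then have "B - I = insert g (B - insert g I)" "finite (B - insert g I)"
      using assms(1) finite_basis by auto
    then show "?p B = y g * (\<Prod>c\<in>B - insert g I. y c)"
      by (metis prod.insert DiffE insertI1)
  qed
  also have "{B\<in>?S. g \<in> B} = {B \<in> bases M. insert g I \<subseteq> B \<and> B \<inter> J = {}}" using assms(2) by auto
  also have "{B\<in>?S. g \<notin> B} = {B \<in> bases M. I \<subseteq> B \<and> B \<inter> insert g J = {}}" by auto
  finally show ?thesis by (simp add: basis_poly_def sum_distrib_left)
qed

section \<open>Factorisation of the basis polynomials of the 2-sum\<close>

text \<open>The contribution of the bases that take \<open>g\<close> from \<open>M\<close>. They
  correspond bijectively to pairs of bases, and both the constraints and the monomials split over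
  the two ground sets. The other half follows by exchanging \<open>M\<close> and
  \<open>Q\<close>.\<close>

lemma sum_two_sum_bases:
  assumes "matroid M" "matroid Q" and ground: "ground M \<inter> ground Q = {g}"
    and I: "I \<subseteq> ground M - {g}" "I' \<subseteq> ground Q - {g}"
    and J: "J \<subseteq> ground M - {g}" "J' \<subseteq> ground Q - {g}"
  shows "(\<Sum>C | C \<in> (\<lambda>(A, B). A \<union> B - {g}) ` ({A\<in>bases M. g \<in> A} \<times> {B\<in>bases Q. g \<notin> B}) \<and>
        I \<union> I' \<subseteq> C \<and> C \<inter> (J \<union> J') = {}. \<Prod>c\<in>C - (I \<union> I'). y c) =
    basis_poly M (insert g I) J y * basis_poly Q I' (insert g J') y"
proof -
  interpret M: matroid M by fact
  interpret Q: matroid Q by fact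
  let ?u = "\<lambda>(A, B). A \<union> B - {g}"
  let ?P = "{A \<in> bases M. insert g I \<subseteq> A \<and> A \<inter> J = {}}"
  let ?R = "{B \<in> bases Q. I' \<subseteq> B \<and> B \<inter> insert g J' = {}}"
  \<comment> \<open>Restricting to the two ground sets recovers \<open>B\<close>, and
    \<open>A\<close> up to the known element \<open>g\<close>; hence injectivity.\<close>
  have restrict: "(A \<union> B - {g}) \<inter> ground M = A - {g}" "(A \<union> B - {g}) \<inter> ground Q = B"
    if "A \<in> bases M" "B \<in> bases Q" "g \<notin> B" for A B
    using M.bases_subset[OF that(1)] Q.bases_subset[OF that(2)] that(3) ground by blast+
  have inj: "inj_on ?u (?P \<times> ?R)"
  proof (rule inj_onI)
    fix S T assume ST: "S \<in> ?P \<times> ?R" "T \<in> ?P \<times> ?R" "?u S = ?u T"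
    obtain A B A' B' where [simp]: "S = (A, B)" "T = (A', B')" by fastforce
    have mem: "A \<in> bases M" "B \<in> bases Q" "g \<in> A" "g \<notin> B"
      "A' \<in> bases M" "B' \<in> bases Q" "g \<in> A'" "g \<notin> B'"
      using ST(1,2) by simp_all
    have "A \<union> B - {g} = A' \<union> B' - {g}" using ST(3) by simp
    then have "A - {g} = A' - {g}" "B = B'"
      using restrict[OF mem(1,2,4)] restrict[OF mem(5,6,8)] by simp_all
    moreover from this mem(3,7) have "A = A'" by blast
    ultimately show "S = T" by simp
  qed
  have split: "I \<subseteq> A \<union> B - {g} \<longleftrightarrow> I \<subseteq> A" "I' \<subseteq> A \<union> B - {g} \<longleftrightarrow> I' \<subseteq> B"
    "(A \<union> B - {g}) \<inter> (J \<union> J') = {} \<longleftrightarrow> A \<inter> J = {} \<and> B \<inter> J' = {}"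
    if "A \<in> bases M" "B \<in> bases Q" for A B
    using M.bases_subset[OF that(1)] Q.bases_subset[OF that(2)] ground I J by blast+
  have eq: "{C. C \<in> ?u ` ({A\<in>bases M. g \<in> A} \<times> {B\<in>bases Q. g \<notin> B}) \<and>
      I \<union> I' \<subseteq> C \<and> C \<inter> (J \<union> J') = {}} = ?u ` (?P \<times> ?R)"
  proof (rule set_eqI)
    fix C
    have "C \<in> ?u ` ({A\<in>bases M. g \<in> A} \<times> {B\<in>bases Q. g \<notin> B}) \<and>
        I \<union> I' \<subseteq> C \<and> C \<inter> (J \<union> J') = {} \<longleftrightarrow>
      (\<exists>A\<in>bases M. \<exists>B\<in>bases Q. g \<in> A \<and> g \<notin> B \<and> C = A \<union> B - {g} \<and>
        I \<union> I' \<subseteq> A \<union> B - {g} \<and> (A \<union> B - {g}) \<inter> (J \<union> J') = {})"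
      by auto
    also have "\<dots> \<longleftrightarrow> (\<exists>A\<in>bases M. \<exists>B\<in>bases Q. g \<in> A \<and> g \<notin> B \<and> C = A \<union> B - {g} \<and>
        (I \<subseteq> A \<and> I' \<subseteq> B) \<and> A \<inter> J = {} \<and> B \<inter> J' = {})"
      by (simp add: split cong: bex_cong)
    also have "\<dots> \<longleftrightarrow> C \<in> ?u ` (?P \<times> ?R)"
      by auto
    finally show "C \<in> {C. C \<in> ?u ` ({A\<in>bases M. g \<in> A} \<times> {B\<in>bases Q. g \<notin> B}) \<and>
        I \<union> I' \<subseteq> C \<and> C \<inter> (J \<union> J') = {}} \<longleftrightarrow> C \<in> ?u ` (?P \<times> ?R)"
      by simp
  qed
  show ?thesis
    unfolding eq sum.reindex[OF inj] basis_poly_def sum_product sum.cartesian_product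
  proof (rule sum.cong[OF refl], clarify, simp, goal_cases)
    case (1 A B)
    then have "A \<union> B - {g} - (I \<union> I') = (A - insert g I) \<union> (B - I')"
      "(A - insert g I) \<inter> (B - I') = {}"
      using M.bases_subset[of A] Q.bases_subset[of B] ground I by blast+
    then show ?case
      using 1 M.finite_basis Q.finite_basis by (simp add: prod.union_disjoint)
  qed
qed

lemma basis_poly_two_sum:
  assumes MQ: "matroid M" "matroid Q" and ground: "ground M \<inter> ground Q = {g}"
    and I: "I \<subseteq> ground M - {g}" "I' \<subseteq> ground Q - {g}"
    and J: "J \<subseteq> ground M - {g}" "J' \<subseteq> ground Q - {g}"
  shows "basis_poly (two_sum M g Q) (I \<union> I') (J \<union> J') y =
      basis_poly M (insert g I) J y * basis_poly Q I' (insert g J') y +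
      basis_poly M I (insert g J) y * basis_poly Q (insert g I') J' y"
proof -
  interpret M: matroid M by fact
  interpret Q: matroid Q by fact
  let ?u = "\<lambda>(A, B). A \<union> B - {g}"
  define X where "X = ?u ` ({A\<in>bases M. g \<in> A} \<times> {B\<in>bases Q. g \<notin> B})"
  \<comment> \<open>The factors are listed with \<open>Q\<close> first, to fit
    \<open>sum_two_sum_bases\<close> with the roles of \<open>M\<close> and \<open>Q\<close>
    exchanged.\<close>
  define Y where "Y = ?u ` ({B\<in>bases Q. g \<in> B} \<times> {A\<in>bases M. g \<notin> A})"
  let ?c = "\<lambda>C. I \<union> I' \<subseteq> C \<and> C \<inter> (J \<union> J') = {}"
  have X: "C \<in> X \<longleftrightarrow> (\<exists>A\<in>bases M. \<exists>B\<in>bases Q. g \<in> A \<and> g \<notin> B \<and> C = A \<union> B - {g})" for C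
    unfolding X_def by auto
  have Y: "C \<in> Y \<longleftrightarrow> (\<exists>A\<in>bases M. \<exists>B\<in>bases Q. g \<notin> A \<and> g \<in> B \<and> C = A \<union> B - {g})" for C
    unfolding Y_def by (auto simp: Un_commute)
  have "C \<in> bases (two_sum M g Q) \<longleftrightarrow> C \<in> X \<or> C \<in> Y" for C
    unfolding two_sum_bases_iff X Y by blast
  then have eq: "{C. C \<in> bases (two_sum M g Q) \<and> ?c C} = {C. C \<in> X \<and> ?c C} \<union> {C. C \<in> Y \<and> ?c C}"
    by blast
  \<comment> \<open>A common member would have \<open>M\<close>-parts \<open>A\<close> containing
    \<open>g\<close> and \<open>A'\<close> avoiding it, with \<open>A'\<close> inside
    \<open>A\<close>, against the antichain property.\<close>
  have "C \<notin> Y" if "C \<in> X" for C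
  proof
    assume "C \<in> Y"
    then obtain A' B' where Y': "A' \<in> bases M" "g \<notin> A'" "B' \<in> bases Q" "C = A' \<union> B' - {g}"
      unfolding Y by blast
    from that obtain A B where X': "A \<in> bases M" "g \<in> A" "B \<in> bases Q" "C = A \<union> B - {g}"
      unfolding X by blast
    have "A' \<subseteq> A"
      using M.bases_subset[OF Y'(1)] Q.bases_subset[OF X'(3)] Y'(2,4) X'(4) ground by blast
    then show False using M.basis_antichain[OF X'(1) Y'(1)] X'(2) Y'(2) by blast
  qed
  then have disj: "{C. C \<in> X \<and> ?c C} \<inter> {C. C \<in> Y \<and> ?c C} = {}" by blast
  have fin: "finite {C. C \<in> X \<and> ?c C}" "finite {C. C \<in> Y \<and> ?c C}"
    using M.finite_bases Q.finite_bases by (simp_all add: X_def Y_def)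
  have ground': "ground Q \<inter> ground M = {g}" using ground by blast
  show ?thesis
    unfolding basis_poly_def[of "two_sum M g Q"] eq sum.union_disjoint[OF fin disj]
    using sum_two_sum_bases[OF MQ ground I J, of y]
      sum_two_sum_bases[OF MQ(2,1) ground' I(2,1) J(2,1), of y]
    by (simp add: X_def Y_def Un_commute mult.commute)
qed

section \<open>Rayleigh differences of the 2-sum\<close>

text \<open>For positive \<open>s\<close> and \<open>t\<close> this is the hypothesis at
  \<open>s / t\<close>, scaled by the square of \<open>t\<close>; the boundary of the quadrant
  follows by continuity.\<close>

lemma quadratic_form_nonneg:
  fixes a b c s t :: real
  assumes "\<And>x. 0 < x \<Longrightarrow> 0 \<le> a * x\<^sup>2 + b * x + c" and "0 \<le> s" "0 \<le> t"
  shows "0 \<le> a * s\<^sup>2 + b * s * t + c * t\<^sup>2"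
proof -
  let ?q = "\<lambda>s t. a * s\<^sup>2 + b * s * t + c * t\<^sup>2"
  have pos: "0 \<le> ?q s t" if "0 < s" "0 < t" for s t
  proof -
    have "0 \<le> t\<^sup>2 * (a * (s / t)\<^sup>2 + b * (s / t) + c)" using assms(1)[of "s / t"] that by simp
    also have "\<dots> = ?q s t" using that by (simp add: field_simps power2_eq_square)
    finally show ?thesis .
  qed
  \<comment> \<open>Shifting both arguments by a small positive \<open>x\<close> moves the point
    into the open quadrant.\<close>
  have "((\<lambda>x. ?q (s + x) (t + x)) \<longlongrightarrow> ?q (s + 0) (t + 0)) (at_right 0)"
    by (intro tendsto_intros)
  moreover have "\<forall>\<^sub>F x in at_right 0. 0 \<le> ?q (s + x) (t + x)"
    using eventually_at_right_less[of 0] by eventually_elim (use assms(2,3) in \<open>auto intro!: pos\<close>)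
  ultimately have "0 \<le> ?q (s + 0) (t + 0)"
    by (rule tendsto_lowerbound) simp
  then show ?thesis by simp
qed

lemma rayleigh_difference_commute: "rayleigh_difference M e f y = rayleigh_difference M f e y"
  by (simp add: rayleigh_difference_def insert_commute mult.commute)

lemma rayleigh_matroidD:
  assumes "rayleigh_matroid M" "e \<in> ground M" "f \<in> ground M" "e \<noteq> f"
    "\<And>c. c \<in> ground M \<Longrightarrow> 0 < y c"
  shows "0 \<le> rayleigh_difference M e f y"
  using assms unfolding rayleigh_matroid_def by blast

lemma rayleigh_difference_two_sum_same_side:
  assumes M: "rayleigh_matroid M" and Q: "matroid Q" and ground: "ground M \<inter> ground Q = {g}"
    and ef: "e \<in> ground M - {g}" "f \<in> ground M - {g}" "e \<noteq> f"
    and y: "\<And>c. c \<in> ground M \<union> ground Q - {g} \<Longrightarrow> 0 < y c"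
  shows "0 \<le> rayleigh_difference (two_sum M g Q) e f y"
proof -
  interpret M: matroid M using M by (simp add: rayleigh_matroid_def)
  interpret Q: matroid Q by fact
  let ?m = "\<lambda>I J. basis_poly M I J y"
  \<comment> \<open>\<open>Q\<close> enters only through \<open>s\<close> and \<open>t\<close>.
    Either can vanish: \<open>s\<close> if \<open>g\<close> is a coloop of \<open>Q\<close>,
    \<open>t\<close> if \<open>g\<close> is a loop.\<close>
  define s where "s = basis_poly Q {} {g} y"
  define t where "t = basis_poly Q {g} {} y"
  have N: "basis_poly (two_sum M g Q) I J y = ?m (insert g I) J * s + ?m I (insert g J) * t"
    if "I \<subseteq> ground M - {g}" "J \<subseteq> ground M - {g}" for I J
    using basis_poly_two_sum[OF M.matroid_axioms Q ground that(1) _ that(2), of "{}" "{}" y]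
    by (simp add: s_def t_def)
  have ge: "g \<noteq> e" "g \<noteq> f" using ef by auto
  have st: "0 \<le> s" "0 \<le> t"
    unfolding s_def t_def by (auto intro!: Q.basis_poly_nonneg less_imp_le[OF y])
  \<comment> \<open>This has the shape of \<open>N\<close> with \<open>s\<close> and
    \<open>t\<close> replaced by \<open>x\<close> and 1.\<close>
  have upd: "basis_poly M I J (y(g := x)) = x * ?m (insert g I) J + ?m I (insert g J)"
    if "g \<notin> I" "g \<notin> J" for I J x
  proof -
    have "basis_poly M (insert g I) J (y(g := x)) = ?m (insert g I) J"
      "basis_poly M I (insert g J) (y(g := x)) = ?m I (insert g J)"
      by (auto intro!: basis_poly_cong M.matroid_axioms split: if_splits)
    then show ?thesis
      using M.basis_poly_deletion_contraction[of g I J "y(g := x)"] that by simp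
  qed
  \<comment> \<open>\<open>a\<close>, \<open>b\<close>, \<open>c\<close> are the coefficients of the
    Rayleigh difference of \<open>M\<close> as a quadratic in the value at \<open>g\<close>. The
    same three appear for the 2-sum, as coefficients of a form in \<open>s\<close> and
    \<open>t\<close>.\<close>
  define a where "a = ?m {g, e} {f} * ?m {g, f} {e} - ?m {g, e, f} {} * ?m {g} {e, f}"
  define b where "b = ?m {g, e} {f} * ?m {f} {g, e} + ?m {e} {g, f} * ?m {g, f} {e}
    - ?m {g, e, f} {} * ?m {} {g, e, f} - ?m {e, f} {g} * ?m {g} {e, f}"
  define c where "c = ?m {e} {g, f} * ?m {f} {g, e} - ?m {e, f} {g} * ?m {} {g, e, f}"
  have "0 \<le> a * x\<^sup>2 + b * x + c" if "0 < x" for x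
  proof -
    have "0 \<le> rayleigh_difference M e f (y(g := x))"
      using M ef y that by (intro rayleigh_matroidD) auto
    also have "\<dots> = a * x\<^sup>2 + b * x + c"
      using ef unfolding rayleigh_difference_def a_def b_def c_def
      by (simp add: upd ge algebra_simps power2_eq_square)
    finally show ?thesis .
  qed
  from quadratic_form_nonneg[OF this st] have "0 \<le> a * s\<^sup>2 + b * s * t + c * t\<^sup>2" .
  also have "\<dots> = rayleigh_difference (two_sum M g Q) e f y"
    using ef unfolding rayleigh_difference_def a_def b_def c_def
    by (simp add: N algebra_simps power2_eq_square)
  finally show ?thesis .
qed

text \<open>This is multiplicativity of 2 by 2 determinants: the matrix with rows
  \<open>(N_e^f, N_ef)\<close> and \<open>(N^ef, N_f^e)\<close> is the product of the one with rows
  \<open>(M_eg, M_e^g)\<close> and \<open>(M_g^e, M^eg)\<close> and the one with rows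
  \<open>(Q^fg, Q_f^g)\<close> and \<open>(Q_g^f, Q_fg)\<close>. The factors have determinants minus
  the differences of \<open>M\<close> and \<open>Q\<close>, and the signs cancel.\<close>

lemma rayleigh_difference_two_sum_across:
  assumes MQ: "matroid M" "matroid Q" and ground: "ground M \<inter> ground Q = {g}"
    and ef: "e \<in> ground M - {g}" "f \<in> ground Q - {g}"
  shows "rayleigh_difference (two_sum M g Q) e f y =
    rayleigh_difference M e g y * rayleigh_difference Q f g y"
proof -
  have N: "basis_poly (two_sum M g Q) (I \<union> I') (J \<union> J') y =
      basis_poly M (insert g I) J y * basis_poly Q I' (insert g J') y +
      basis_poly M I (insert g J) y * basis_poly Q (insert g I') J' y"
    if "I \<subseteq> {e}" "I' \<subseteq> {f}" "J \<subseteq> {e}" "J' \<subseteq> {f}" for I I' J J'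
    using that ef by (intro basis_poly_two_sum[OF MQ ground]) auto
  show ?thesis
    using N[of "{e}" "{}" "{}" "{f}"] N[of "{}" "{f}" "{e}" "{}"]
      N[of "{e}" "{f}" "{}" "{}"] N[of "{}" "{}" "{e}" "{f}"]
    unfolding rayleigh_difference_def
    by (simp add: insert_commute algebra_simps)
qed

theorem theorem3p5:
  fixes M Q N :: "'a basis_system" and g :: 'a
  assumes "matroid M" and "matroid Q"
    and "ground M \<inter> ground Q = {g}"
    and "N = two_sum M g Q"
    and two_sum_exists: "bases N \<noteq> {}"
    and "rayleigh_matroid M" and "rayleigh_matroid Q"
  shows "rayleigh_matroid N"
  unfolding rayleigh_matroid_def
proof (intro conjI ballI impI allI)
  show "matroid N"
    using matroid_two_sum[OF assms(1-3)] two_sum_exists by (simp add: assms(4))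
next
  fix e f and y :: "'a \<Rightarrow> real"
  assume e: "e \<in> ground N" and f: "f \<in> ground N" and ef: "e \<noteq> f" and y: "\<forall>c\<in>ground N. 0 < y c"
  have N: "N = two_sum M g Q" "N = two_sum Q g M"
    using assms(4) two_sum_commute by auto
  have ground: "ground M \<inter> ground Q = {g}" "ground Q \<inter> ground M = {g}"
    using assms(3) by auto
  have pos: "0 < y c" if "c \<in> ground M \<union> ground Q - {g}" for c
    using y that by (simp add: N(1) two_sum_def)
  have across: "0 \<le> rayleigh_difference N e f y"
    if "e \<in> ground M - {g}" "f \<in> ground Q - {g}" for e f
  proof -
    \<comment> \<open>\<open>g\<close> is not in \<open>ground N\<close>, so \<open>y g\<close> may
      have any sign, while the Rayleigh hypotheses ask for positivity at \<open>g\<close>. Every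
      polynomial in a difference for a pair containing \<open>g\<close> has \<open>g\<close> as an
      index, so resetting that value to 1 changes nothing.\<close>
    let ?z = "y(g := 1)"
    have "basis_poly K I J ?z = basis_poly K I J y" if "matroid K" "g \<in> I \<union> J" for K I J
      using that by (intro basis_poly_cong) auto
    then have irrel: "rayleigh_difference K h g ?z = rayleigh_difference K h g y" if "matroid K" for K h
      using that by (simp add: rayleigh_difference_def)
    have g: "g \<in> ground M" "g \<in> ground Q" using ground by blast+
    have z: "0 < ?z c" if "c \<in> ground M \<union> ground Q" for c
      using pos that by simp
    have "0 \<le> rayleigh_difference M e g ?z"
      using that(1) g z by (intro rayleigh_matroidD[OF assms(6)]) blast+
    moreover have "0 \<le> rayleigh_difference Q f g ?z"
      using that(2) g z by (intro rayleigh_matroidD[OF assms(7)]) blast+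
    ultimately show ?thesis
      using rayleigh_difference_two_sum_across[OF assms(1-3) that, of y] assms(1,2) N(1)
      by (simp add: irrel)
  qed
  have "e \<in> ground M - {g} \<or> e \<in> ground Q - {g}" "f \<in> ground M - {g} \<or> f \<in> ground Q - {g}"
    using e f by (auto simp: N(1) two_sum_def)
  then consider "e \<in> ground M - {g}" "f \<in> ground M - {g}" | "e \<in> ground Q - {g}" "f \<in> ground Q - {g}"
    | "e \<in> ground M - {g}" "f \<in> ground Q - {g}" | "f \<in> ground M - {g}" "e \<in> ground Q - {g}"
    by blast
  then show "0 \<le> rayleigh_difference N e f y"
  proof cases
    case 1
    show ?thesis
      unfolding N(1) using 1 ef pos
      by (rule rayleigh_difference_two_sum_same_side[OF assms(6,2) ground(1)])
  next
    case 2
    show ?thesis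
      unfolding N(2) using 2 ef pos[unfolded Un_commute[of "ground M"]]
      by (rule rayleigh_difference_two_sum_same_side[OF assms(7,1) ground(2)])
  next
    case 3
    then show ?thesis by (rule across)
  next
    case 4
    then show ?thesis using across rayleigh_difference_commute by metis
  qed
qed

end
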